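(* The Arithmetic System $\langle R_{0+}^P, L_2^r\cup A_r\rangle$ is consistent in the traditional sense: there is no formula $\alpha\in S_A$ such that both $\alpha\in Cn(R_{0+}^P, L_2^r\cup A_r)$ and $\sim\alpha\in Cn(R_{0+}^P, L_2^r\cup A_r)$.
   Context: $S_A$ is the set of all well-formed first-order formulas of the Arithmetic System, built from individual variables $x_1,x_2,\dots$, the constant $1$, the binary function symbols $+,\cdot$, the binary predicate symbols $=,<$, the connectives $\to,\sim,\vee,\wedge,\equiv$ (implication, negation, disjunction, conjunction, equivalence) and the quantifiers $\forall,\exists$. $R_{0+}^P$ consists of two rules over $S_A$: Modus Ponens and the generalization rule (from $\phi$ infer $\forall x_k\,\phi$). For $X\subseteq S_A$ and a set $R$ of rules, $Cn(R,X)$ is the smallest subset of $S_A$ containing $X$ and closed under the rules in $R$. $L_2^r$ is the set of all logical axioms of the Arithmetic System, i.e. the formulas of $S_A$ valid in the classical predicate calculus (with $=$ treated as a non-logical predicate symbol). $A_r=X_P\cup Y_P$ is the set of specific axioms. $X_P=\{\psi^1,\dots,\psi^{12}\}$, where $\psi^1$: $\forall x_1(x_1=x_1)$; $\psi^2$: $\forall x_1\forall x_2(x_1=x_2\to x_2=x_1)$; $\psi^3$: $\forall x_1\forall x_2\forall x_3(x_1=x_2\to(x_2=x_3\to x_1=x_3))$; $\psi^4$: $\forall x_1\forall x_2\forall x_3\forall x_4(x_1=x_2\to(x_3=x_4\to(x_1+x_3=x_2+x_4)))$; $\psi^5$: $\forall x_1\forall x_2\forall x_3\forall x_4(x_1=x_2\to(x_3=x_4\to(x_1\cdot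 x_3=x_2\cdot x_4)))$; $\psi^6$: $\forall x_1\forall x_2\forall x_3\forall x_4(x_1=x_2\to(x_3=x_4\to(x_1<x_3\to x_2<x_4)))$; $\psi^7$: $\forall x_1\sim(1=x_1+1)$; $\psi^8$: $\forall x_1\forall x_2(x_1+1=x_2+1\to x_1=x_2)$; $\psi^9$: $\forall x_1\forall x_2(x_1+(x_2+1)=(x_1+x_2)+1)$; $\psi^{10}$: $\forall x_1(x_1\cdot 1=x_1)$; $\psi^{11}$: $\forall x_1\forall x_2(x_1\cdot(x_2+1)=(x_1\cdot x_2)+x_1)$; $\psi^{12}$: $\forall x_1\forall x_2(x_1<x_2\equiv\exists x_3(x_1+x_3=x_2))$. $Y_P$ is the set of all induction axioms $(\phi(1)\wedge\forall x_1(\phi(x_1)\to\phi(x_1+1)))\to\forall x_1\phi(x_1)$, with $\phi(1),\phi(x_1),\phi(x_1+1)\in S_A$. *)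

theory Defs
  imports "HOL-Library.Infinite_Typeclass"
begin

section \<open>Syntax\<close>

text \<open>
  The individual variables of the paper are \<open>x\<^sub>1, x\<^sub>2, \<dots>\<close>; here \<open>Var n\<close> stands for
  \<open>x\<close> with index \<open>n + 1\<close>, and likewise \<open>All n\<close>, \<open>Ex n\<close> bind the variable with index \<open>n + 1\<close>.
  The set \<open>S\<^sub>A\<close> of well-formed formulas is the whole type \<open>fm\<close>.
\<close>

datatype tm =
    Var nat
  | One  (\<open>\<^bold>1\<close>)
  | Plus tm tm  (infixl \<open>\<^bold>+\<close> 65)
  | Times tm tm  (infixl \<open>\<^bold>\<cdot>\<close> 70)

datatype fm =
    Eq tm tm  (infix \<open>\<^bold>=\<close> 50)
  | Less tm tm  (infix \<open>\<^bold><\<close> 50)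
  | Imp fm fm  (infixr \<open>\<^bold>\<longrightarrow>\<close> 25)
  | Neg fm  (\<open>\<^bold>\<sim> _\<close> [40] 40)
  | Or fm fm  (infixr \<open>\<^bold>\<or>\<close> 30)
  | And fm fm  (infixr \<open>\<^bold>\<and>\<close> 35)
  | Equiv fm fm  (infixr \<open>\<^bold>\<equiv>\<close> 25)
  | All nat fm
  | Ex nat fm

abbreviation x1 :: tm where "x1 \<equiv> Var 0"
abbreviation x2 :: tm where "x2 \<equiv> Var 1"
abbreviation x3 :: tm where "x3 \<equiv> Var 2"
abbreviation x4 :: tm where "x4 \<equiv> Var 3"
abbreviation all_x1 :: "fm \<Rightarrow> fm" (\<open>\<^bold>\<forall>x1 _\<close> [40] 40) where "\<^bold>\<forall>x1 \<phi> \<equiv> All 0 \<phi>"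
abbreviation all_x2 :: "fm \<Rightarrow> fm" (\<open>\<^bold>\<forall>x2 _\<close> [40] 40) where "\<^bold>\<forall>x2 \<phi> \<equiv> All 1 \<phi>"
abbreviation all_x3 :: "fm \<Rightarrow> fm" (\<open>\<^bold>\<forall>x3 _\<close> [40] 40) where "\<^bold>\<forall>x3 \<phi> \<equiv> All 2 \<phi>"
abbreviation all_x4 :: "fm \<Rightarrow> fm" (\<open>\<^bold>\<forall>x4 _\<close> [40] 40) where "\<^bold>\<forall>x4 \<phi> \<equiv> All 3 \<phi>"
abbreviation ex_x3 :: "fm \<Rightarrow> fm" (\<open>\<^bold>\<exists>x3 _\<close> [40] 40) where "\<^bold>\<exists>x3 \<phi> \<equiv> Ex 2 \<phi>"

primrec subst_tm :: "nat \<Rightarrow> tm \<Rightarrow> tm \<Rightarrow> tm" where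
  "subst_tm k t (Var n) = (if n = k then t else Var n)"
| "subst_tm k t \<^bold>1 = \<^bold>1"
| "subst_tm k t (a \<^bold>+ b) = subst_tm k t a \<^bold>+ subst_tm k t b"
| "subst_tm k t (a \<^bold>\<cdot> b) = subst_tm k t a \<^bold>\<cdot> subst_tm k t b"

text \<open>
  Replacement of the free occurrences of a variable, without renaming. Below it is used only with
  \<open>\<^bold>1\<close> and \<open>x1 \<^bold>+ \<^bold>1\<close> for \<open>x1\<close>; since no free occurrence of \<open>x1\<close> lies in the scope of a
  quantifier binding \<open>x1\<close>, no variable can be captured.
\<close>

primrec subst :: "nat \<Rightarrow> tm \<Rightarrow> fm \<Rightarrow> fm" where
  "subst k t (a \<^bold>= b) = (subst_tm k t a \<^bold>= subst_tm k t b)"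
| "subst k t (a \<^bold>< b) = (subst_tm k t a \<^bold>< subst_tm k t b)"
| "subst k t (\<phi> \<^bold>\<longrightarrow> \<psi>) = (subst k t \<phi> \<^bold>\<longrightarrow> subst k t \<psi>)"
| "subst k t (\<^bold>\<sim> \<phi>) = (\<^bold>\<sim> subst k t \<phi>)"
| "subst k t (\<phi> \<^bold>\<or> \<psi>) = (subst k t \<phi> \<^bold>\<or> subst k t \<psi>)"
| "subst k t (\<phi> \<^bold>\<and> \<psi>) = (subst k t \<phi> \<^bold>\<and> subst k t \<psi>)"
| "subst k t (\<phi> \<^bold>\<equiv> \<psi>) = (subst k t \<phi> \<^bold>\<equiv> subst k t \<psi>)"
| "subst k t (All n \<phi>) = (if n = k then All n \<phi> else All n (subst k t \<phi>))"
| "subst k t (Ex n \<phi>) = (if n = k then Ex n \<phi> else Ex n (subst k t \<phi>))"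


section \<open>Rules and consequences\<close>

text \<open>A rule is a set of pairs (list of premises, conclusion).\<close>

type_synonym rule = "(fm list \<times> fm) set"

definition modus_ponens :: rule where
  "modus_ponens = {([\<phi> \<^bold>\<longrightarrow> \<psi>, \<phi>], \<psi>) | \<phi> \<psi>. True}"

definition generalization :: rule where
  "generalization = {([\<phi>], All k \<phi>) | \<phi> k. True}"

definition R0P :: "rule set" where
  "R0P = {modus_ponens, generalization}"

definition closed_under :: "rule \<Rightarrow> fm set \<Rightarrow> bool" where
  "closed_under r Y \<longleftrightarrow> (\<forall>(ps, c) \<in> r. set ps \<subseteq> Y \<longrightarrow> c \<in> Y)"

definition Cn :: "rule set \<Rightarrow> fm set \<Rightarrow> fm set" where
  "Cn R X = \<Inter>{Y. X \<subseteq> Y \<and> (\<forall>r\<in>R. closed_under r Y)}"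


section \<open>Logical axioms\<close>

text \<open>Both predicate symbols, \<open>=\<close> included, are interpreted by arbitrary binary relations.\<close>

record 'u interp =
  univ :: "'u set"
  one_elt :: 'u
  plus_op :: "'u \<Rightarrow> 'u \<Rightarrow> 'u"
  times_op :: "'u \<Rightarrow> 'u \<Rightarrow> 'u"
  eq_rel :: "'u \<Rightarrow> 'u \<Rightarrow> bool"
  less_rel :: "'u \<Rightarrow> 'u \<Rightarrow> bool"

definition is_interp :: "'u interp \<Rightarrow> bool" where
  "is_interp M \<longleftrightarrow> one_elt M \<in> univ M \<and>
     (\<forall>a\<in>univ M. \<forall>b\<in>univ M. plus_op M a b \<in> univ M \<and> times_op M a b \<in> univ M)"

primrec val :: "'u interp \<Rightarrow> (nat \<Rightarrow> 'u) \<Rightarrow> tm \<Rightarrow> 'u" where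
  "val M e (Var n) = e n"
| "val M e \<^bold>1 = one_elt M"
| "val M e (a \<^bold>+ b) = plus_op M (val M e a) (val M e b)"
| "val M e (a \<^bold>\<cdot> b) = times_op M (val M e a) (val M e b)"

primrec sat :: "'u interp \<Rightarrow> (nat \<Rightarrow> 'u) \<Rightarrow> fm \<Rightarrow> bool" where
  "sat M e (a \<^bold>= b) \<longleftrightarrow> eq_rel M (val M e a) (val M e b)"
| "sat M e (a \<^bold>< b) \<longleftrightarrow> less_rel M (val M e a) (val M e b)"
| "sat M e (\<phi> \<^bold>\<longrightarrow> \<psi>) \<longleftrightarrow> (sat M e \<phi> \<longrightarrow> sat M e \<psi>)"
| "sat M e (\<^bold>\<sim> \<phi>) \<longleftrightarrow> \<not> sat M e \<phi>"
| "sat M e (\<phi> \<^bold>\<or> \<psi>) \<longleftrightarrow> sat M e \<phi> \<or> sat M e \<psi>"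
| "sat M e (\<phi> \<^bold>\<and> \<psi>) \<longleftrightarrow> sat M e \<phi> \<and> sat M e \<psi>"
| "sat M e (\<phi> \<^bold>\<equiv> \<psi>) \<longleftrightarrow> (sat M e \<phi> \<longleftrightarrow> sat M e \<psi>)"
| "sat M e (All n \<phi>) \<longleftrightarrow> (\<forall>a\<in>univ M. sat M (e(n := a)) \<phi>)"
| "sat M e (Ex n \<phi>) \<longleftrightarrow> (\<exists>a\<in>univ M. sat M (e(n := a)) \<phi>)"

text \<open>
  HOL cannot quantify over all types inside a definition, so the type \<open>'u\<close> from which the
  non-empty domains are drawn is a parameter. It has to be infinite: a finite \<open>'u\<close> would also
  validate formulas that hold only in domains of bounded size. For infinite \<open>'u\<close> the set does not
  depend on \<open>'u\<close>, by the Loewenheim-Skolem theorem.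
\<close>

definition L2r :: "'u::infinite itself \<Rightarrow> fm set" where
  "L2r U = {\<phi>. \<forall>(M :: 'u interp) e. is_interp M \<longrightarrow> range e \<subseteq> univ M \<longrightarrow> sat M e \<phi>}"


section \<open>Specific axioms\<close>

definition X_P :: "fm set" where
  "X_P = {
     \<^bold>\<forall>x1 (x1 \<^bold>= x1),
     \<^bold>\<forall>x1 \<^bold>\<forall>x2 (x1 \<^bold>= x2 \<^bold>\<longrightarrow> x2 \<^bold>= x1),
     \<^bold>\<forall>x1 \<^bold>\<forall>x2 \<^bold>\<forall>x3 (x1 \<^bold>= x2 \<^bold>\<longrightarrow> (x2 \<^bold>= x3 \<^bold>\<longrightarrow> x1 \<^bold>= x3)),
     \<^bold>\<forall>x1 \<^bold>\<forall>x2 \<^bold>\<forall>x3 \<^bold>\<forall>x4 (x1 \<^bold>= x2 \<^bold>\<longrightarrow> (x3 \<^bold>= x4 \<^bold>\<longrightarrow> (x1 \<^bold>+ x3 \<^bold>= x2 \<^bold>+ x4))),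
     \<^bold>\<forall>x1 \<^bold>\<forall>x2 \<^bold>\<forall>x3 \<^bold>\<forall>x4 (x1 \<^bold>= x2 \<^bold>\<longrightarrow> (x3 \<^bold>= x4 \<^bold>\<longrightarrow> (x1 \<^bold>\<cdot> x3 \<^bold>= x2 \<^bold>\<cdot> x4))),
     \<^bold>\<forall>x1 \<^bold>\<forall>x2 \<^bold>\<forall>x3 \<^bold>\<forall>x4 (x1 \<^bold>= x2 \<^bold>\<longrightarrow> (x3 \<^bold>= x4 \<^bold>\<longrightarrow> (x1 \<^bold>< x3 \<^bold>\<longrightarrow> x2 \<^bold>< x4))),
     \<^bold>\<forall>x1 (\<^bold>\<sim> (\<^bold>1 \<^bold>= x1 \<^bold>+ \<^bold>1)),
     \<^bold>\<forall>x1 \<^bold>\<forall>x2 (x1 \<^bold>+ \<^bold>1 \<^bold>= x2 \<^bold>+ \<^bold>1 \<^bold>\<longrightarrow> x1 \<^bold>= x2),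
     \<^bold>\<forall>x1 \<^bold>\<forall>x2 (x1 \<^bold>+ (x2 \<^bold>+ \<^bold>1) \<^bold>= (x1 \<^bold>+ x2) \<^bold>+ \<^bold>1),
     \<^bold>\<forall>x1 (x1 \<^bold>\<cdot> \<^bold>1 \<^bold>= x1),
     \<^bold>\<forall>x1 \<^bold>\<forall>x2 (x1 \<^bold>\<cdot> (x2 \<^bold>+ \<^bold>1) \<^bold>= (x1 \<^bold>\<cdot> x2) \<^bold>+ x1),
     \<^bold>\<forall>x1 \<^bold>\<forall>x2 (x1 \<^bold>< x2 \<^bold>\<equiv> \<^bold>\<exists>x3 (x1 \<^bold>+ x3 \<^bold>= x2))}"

text \<open>\<open>\<phi>\<close> may contain free variables other than \<open>x1\<close>, which act as parameters.\<close>

definition Y_P :: "fm set" where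
  "Y_P = {(subst 0 \<^bold>1 \<phi> \<^bold>\<and> \<^bold>\<forall>x1 (\<phi> \<^bold>\<longrightarrow> subst 0 (x1 \<^bold>+ \<^bold>1) \<phi>)) \<^bold>\<longrightarrow> \<^bold>\<forall>x1 \<phi> | \<phi>. True}"

definition A_r :: "fm set" where
  "A_r = X_P \<union> Y_P"

end

theory Submission
  imports Defs
begin

text \<open>
  The proof is by soundness: the axioms hold in the positive integers with their usual operations
  and order, and a structure in which all axioms hold makes no formula true together with its
  negation. Truth under every assignment is preserved by Modus Ponens and by generalization, so it
  passes from the axioms to all of their consequences (\<open>Cn_R0P_subset_true_in\<close>).

  The logical axioms are the formulas that hold in all structures with domain inside a
  given infinite type, so the positive integers must first be placed inside that type. Any injective
  sequence \<open>f\<close> in the type will do: \<open>f n\<close> plays the part of the integer \<open>n + 1\<close>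
  (\<open>posint_model\<close>). In this copy \<open>=\<close> is true equality, which makes the axioms for \<open>=\<close>
  immediate, and the remaining axioms of \<open>X_P\<close> become elementary facts about natural numbers. The
  induction axioms reduce to induction on \<open>n\<close> once substitution into a formula has been matched
  with a change of the assignment (\<open>sat_subst\<close>).
\<close>

definition true_in :: "'u interp \<Rightarrow> fm set" where
  "true_in M = {\<phi>. \<forall>e. range e \<subseteq> univ M \<longrightarrow> sat M e \<phi>}"

text \<open>
  Generalization preserves truth only because an element of \<open>true_in M\<close> holds under all
  assignments: the one modified at the quantified variable is again an assignment into the domain.
\<close>

lemma Cn_R0P_subset_true_in:
  assumes "X \<subseteq> true_in M"
  shows "Cn R0P X \<subseteq> true_in M"
proof -
  have "closed_under modus_ponens (true_in M)"
    by (auto simp: closed_under_def modus_ponens_def true_in_def)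
  moreover have "sat M (e(k := a)) \<phi>"
    if "\<phi> \<in> true_in M" "range e \<subseteq> univ M" "a \<in> univ M" for \<phi> e k a
  proof -
    have "range (e(k := a)) \<subseteq> univ M"
      using that by auto
    with that show ?thesis
      unfolding true_in_def by blast
  qed
  then have "closed_under generalization (true_in M)"
    by (auto simp: closed_under_def generalization_def) (auto simp: true_in_def)
  ultimately show ?thesis
    using assms unfolding Cn_def R0P_def by blast
qed

lemma not_both_true_in:
  assumes "is_interp M"
  shows "\<not> (\<alpha> \<in> true_in M \<and> (\<^bold>\<sim> \<alpha>) \<in> true_in M)"
proof -
  have "range (\<lambda>_ :: nat. one_elt M) \<subseteq> univ M"
    using assms by (auto simp: is_interp_def)
  then show ?thesis
    by (fastforce simp: true_in_def)
qed

lemma val_subst_tm: "val M e (subst_tm k t s) = val M (e(k := val M e t)) s"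
  by (induction s) auto

text \<open>
  Since \<open>subst\<close> does not rename bound variables, it could let a quantifier capture a variable
  of \<open>t\<close>. The hypothesis excludes this semantically: \<open>t\<close> depends on no variable but the one that
  it replaces, and below a quantifier for that variable no replacement takes place.
\<close>

lemma sat_subst:
  assumes "\<And>e n a. n \<noteq> k \<Longrightarrow> val M (e(n := a)) t = val M e t"
  shows "sat M e (subst k t \<phi>) \<longleftrightarrow> sat M (e(k := val M e t)) \<phi>"
proof (induction \<phi> arbitrary: e)
  case (All n \<phi>)
  (* The induction hypothesis holds its assignment eta-expanded, so \<open>fun_upd_apply\<close> would
     rewrite inside it and hide the updates that \<open>fun_upd_twist\<close> has to exchange. *)
  then show ?case
    by (cases "n = k") (simp_all add: assms fun_upd_twist[of n k] del: fun_upd_apply)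
next
  case (Ex n \<phi>)
  then show ?case
    by (cases "n = k") (simp_all add: assms fun_upd_twist[of n k] del: fun_upd_apply)
qed (simp_all add: val_subst_tm)

text \<open>
  The operations are those of the positive integers transported along \<open>n + 1 \<mapsto> f n\<close>; for
  instance \<open>(m + 1) \<cdot> (n + 1) = (m \<cdot> n + m + n) + 1\<close>.
\<close>

definition posint_model :: "(nat \<Rightarrow> 'u) \<Rightarrow> 'u interp" where
  "posint_model f = \<lparr>
     univ = range f,
     one_elt = f 0,
     plus_op = (\<lambda>a b. f (Suc (inv f a + inv f b))),
     times_op = (\<lambda>a b. f (inv f a * inv f b + inv f a + inv f b)),
     eq_rel = (=),
     less_rel = (\<lambda>a b. inv f a < inv f b)\<rparr>"

lemma is_interp_posint_model: "is_interp (posint_model f)"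
  by (simp add: is_interp_def posint_model_def)

lemma L2r_subset_true_in:
  fixes M :: "'u::infinite interp"
  assumes "is_interp M"
  shows "L2r TYPE('u) \<subseteq> true_in M"
  using assms by (auto simp: L2r_def true_in_def)

text \<open>
  The defining axiom of \<open><\<close> holds because only positive summands are available: \<open>m < n\<close> means
  that \<open>n\<close> exceeds \<open>m\<close> by at least one.
\<close>

lemma X_P_subset_true_in_posint_model:
  assumes "inj f"
  shows "X_P \<subseteq> true_in (posint_model f)"
proof -
  have "(m < n) = (\<exists>d. Suc (m + d) = n)" for m n :: nat
    by (auto simp: less_iff_Suc_add)
  with assms show ?thesis
    by (auto simp: X_P_def true_in_def posint_model_def inj_eq algebra_simps)
qed

lemma Y_P_subset_true_in_posint_model:
  assumes "inj f"
  shows "Y_P \<subseteq> true_in (posint_model f)"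
proof -
  let ?M = "posint_model f"
  have induct: "sat ?M (e(0 := f n)) \<phi>"
    if base: "sat ?M e (subst 0 \<^bold>1 \<phi>)"
      and step: "sat ?M e (\<^bold>\<forall>x1 (\<phi> \<^bold>\<longrightarrow> subst 0 (x1 \<^bold>+ \<^bold>1) \<phi>))"
    for e \<phi> n
  proof (induction n)
    case 0
    have "sat ?M (e(0 := val ?M e \<^bold>1)) \<phi>"
      using base by (subst (asm) sat_subst) auto
    moreover have "val ?M e \<^bold>1 = f 0"
      by (simp add: posint_model_def)
    ultimately show "sat ?M (e(0 := f 0)) \<phi>"
      by (simp only:)
  next
    case (Suc n)
    have "f n \<in> univ ?M"
      by (simp add: posint_model_def)
    moreover have "sat ?M (e(0 := f n)) \<phi>"
      by (rule Suc.IH)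
    ultimately have "sat ?M (e(0 := f n)) (subst 0 (x1 \<^bold>+ \<^bold>1) \<phi>)"
      using step by simp
    then have "sat ?M (e(0 := f n, 0 := val ?M (e(0 := f n)) (x1 \<^bold>+ \<^bold>1))) \<phi>"
      by (subst (asm) sat_subst) auto
    moreover have "val ?M (e(0 := f n)) (x1 \<^bold>+ \<^bold>1) = f (Suc n)"
      using assms by (simp add: posint_model_def)
    ultimately show "sat ?M (e(0 := f (Suc n))) \<phi>"
      by (simp only: fun_upd_upd)
  qed
  have univ: "univ ?M = range f"
    by (simp add: posint_model_def)
  have "sat ?M e (\<^bold>\<forall>x1 \<phi>)"
    if "sat ?M e (subst 0 \<^bold>1 \<phi>)" "sat ?M e (\<^bold>\<forall>x1 (\<phi> \<^bold>\<longrightarrow> subst 0 (x1 \<^bold>+ \<^bold>1) \<phi>))" for e \<phi>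
    using induct[OF that] by (simp only: sat.simps univ ball_simps) blast
  then have "sat ?M e ((subst 0 \<^bold>1 \<phi> \<^bold>\<and> \<^bold>\<forall>x1 (\<phi> \<^bold>\<longrightarrow> subst 0 (x1 \<^bold>+ \<^bold>1) \<phi>)) \<^bold>\<longrightarrow> \<^bold>\<forall>x1 \<phi>)" for e \<phi>
    by (simp only: sat.simps(3,6)) blast
  then show ?thesis
    unfolding Y_P_def true_in_def by blast
qed

theorem theorem5p1:
  shows "\<not> (\<exists>\<alpha> :: fm. \<alpha> \<in> Cn R0P (L2r TYPE('u::infinite) \<union> A_r) \<and>
                      (\<^bold>\<sim> \<alpha>) \<in> Cn R0P (L2r TYPE('u) \<union> A_r))"
proof -
  obtain f :: "nat \<Rightarrow> 'u" where "inj f"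
    using infinite_countable_subset[OF infinite_UNIV] by blast
  let ?M = "posint_model f"
  have "L2r TYPE('u) \<union> A_r \<subseteq> true_in ?M"
    unfolding A_r_def
    using L2r_subset_true_in[OF is_interp_posint_model]
      X_P_subset_true_in_posint_model[OF \<open>inj f\<close>]
      Y_P_subset_true_in_posint_model[OF \<open>inj f\<close>]
    by blast
  then have "Cn R0P (L2r TYPE('u) \<union> A_r) \<subseteq> true_in ?M"
    by (rule Cn_R0P_subset_true_in)
  then show ?thesis
    using not_both_true_in[OF is_interp_posint_model] by blast
qed

end
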